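(* Let $n_0\ge1$ be an integer and let $(a_j)_{-n_0\le j\le n_0}$ be complex numbers with $a_j=\overline{a_{-j}}$ for all $j$. Put $K(z)=\sum_{m=-n_0}^{n_0}a_m z^{m+n_0}$. Assume that $K$ has no root of modulus $1$, that $K$ has $n_0$ roots of modulus less than $1$ and $n_0$ roots of modulus greater than $1$ (counted with multiplicity), and that $K$ has leading coefficient $1$. Let $\alpha_1,\dots,\alpha_\sigma$ be the distinct roots of $K$ of modulus strictly less than $1$. Let $T_N$ be the $(N+1)\times(N+1)$ banded Toeplitz matrix with entries $(T_N)_{i,j}=a_{j-i}$ if $|i-j|\le n_0$ and $(T_N)_{i,j}=0$ if $|i-j|>n_0$. Then: (i) $T_N$ is invertible. (ii) Let $0<x<1$. If $|k-l|=Nx$ (with $k,l$ integers, $0\le k,l\le N$), then for every real $a\in]0,1[$ and every real $\rho$ with $1>\rho>\max\{|\alpha_i| : 1\le i\le\sigma\}$, $$\left(T_N^{-1}\right)_{k+1,l+1}=o\left(\rho^{a|k-l|}\right)\quad\text{as } N\to+\infty,$$ i.e. for every $\varepsilon>0$ there is $N_1$ such that $|(T_N^{-1})_{k+1,l+1}|\le\varepsilon\rho^{a|k-l|}$ for all $N\ge N_1$ and all integers $0\le k,l\le N$ with $|k-l|=Nx$.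
   Context: The matrix $T_N$ has as symbol the function $\phi(e^{i\theta})=\sum_{n=-n_0}^{n_0}a_n e^{in\theta}$. Rows and columns of $T_N$ are indexed from $1$ to $N+1$. *)

theory Defs
  imports
    Complex_Main
    "HOL-Computational_Algebra.Polynomial"
    "Jordan_Normal_Form.Gauss_Jordan_Elimination"
begin

(* Coefficients are given by a :: int => complex; only the values a j with |j| <= n0 are used. *)

definition symbol_poly :: "nat \<Rightarrow> (int \<Rightarrow> complex) \<Rightarrow> complex poly" where
  "symbol_poly n0 a = (\<Sum>m\<in>{-int n0..int n0}. monom (a m) (nat (m + int n0)))"

definition num_roots :: "complex poly \<Rightarrow> (complex \<Rightarrow> bool) \<Rightarrow> nat" where
  "num_roots p P = (\<Sum>z\<in>{z. poly p z = 0 \<and> P z}. order z p)"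

(* Matrices of Jordan_Normal_Form are indexed from 0: the entry in row i+1 and column j+1
   of T_N is banded_toeplitz n0 a N $$ (i, j). *)
definition banded_toeplitz :: "nat \<Rightarrow> (int \<Rightarrow> complex) \<Rightarrow> nat \<Rightarrow> complex mat" where
  "banded_toeplitz n0 a N =
     mat (N + 1) (N + 1)
       (\<lambda>(i, j). if \<bar>int i - int j\<bar> \<le> int n0 then a (int j - int i) else 0)"

(* mat_inverse returns Some of the inverse exactly for invertible square matrices,
   so mat_inv A is the inverse of A when A is invertible and unspecified otherwise. *)
definition mat_inv :: "complex mat \<Rightarrow> complex mat" where
  "mat_inv A = the (mat_inverse A)"

end

theory Submission
  imports Defs
    "HOL-Computational_Algebra.Fundamental_Theorem_Algebra"
    "Jordan_Normal_Form.Determinant"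
begin

text \<open>
  On the unit circle the symbol is real, continuous and without zeros, so it has constant sign and
  modulus at least some \<open>c > 0\<close>. Discretising the integral that represents the quadratic form of
  the Toeplitz matrix (a sum over sufficiently many roots of unity is exact) shows that the form is
  definite with constant \<open>c\<close>, so the matrix is invertible and the entries of its inverse are
  at most \<open>1 / c\<close>, uniformly in the size.

  For the decay, let \<open>V\<close> be the polynomial whose coefficients are the entries left of the
  diagonal in row \<open>k\<close> of the inverse. The coefficients of \<open>K V\<close> from degree \<open>n\<^sub>0\<close> on vanish below
  degree \<open>k\<close> and are bounded afterwards. With \<open>r = 1 / \<rho>\<close>, growth of order \<open>r ^ i\<close> survives division by
  each linear factor of \<open>K\<close>: a root of modulus less than \<open>\<rho>\<close> is divided out by solving
  the recurrence downwards from the top coefficient (which costs one of the \<open>n\<^sub>0\<close> low degrees), a root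
  outside the unit disc by solving it upwards from degree \<open>0\<close>. Hence the entries decay like
  \<open>\<rho> ^ (k - l)\<close>; the entries right of the diagonal follow by Hermitian symmetry.
\<close>

section \<open>Coefficient growth under division by the linear factors of a monic polynomial\<close>

lemma coeff_bound_div_small_root:
  fixes V :: "'a::real_normed_field poly"
  assumes r: "r > 0" "norm \<alpha> * r < 1" and C: "0 \<le> C"
    and bd: "\<And>i. norm (coeff ([:-\<alpha>, 1:] * V) (Suc (d + i))) \<le> C * r ^ i"
  shows "norm (coeff V (d + i)) \<le> C / (1 - norm \<alpha> * r) * r ^ i"
proof -
  \<comment> \<open>D is the fixed point of the map sending D to C + |\<alpha>| r D, so the bound D
    r^i reproduces itself along the downward recurrence.\<close>
  define D where "D = C / (1 - norm \<alpha> * r)"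
  have D: "D \<ge> 0" "C + norm \<alpha> * r * D = D"
    using r C by (auto simp: D_def field_simps)
  \<comment> \<open>The auxiliary n measures how far i may lie below the top: for n = 0 the index is
    beyond the degree and the coefficient vanishes. Each induction step descends by one
    index.\<close>
  have "norm (coeff V (d + i)) \<le> D * r ^ i" if "i + n > degree V" for n i
    using that
  proof (induction n arbitrary: i)
    case 0
    then show ?case using D r by (simp add: coeff_eq_0)
  next
    case (Suc n)
    have IH: "norm (coeff V (d + Suc i)) \<le> D * r ^ Suc i"
      using Suc.IH[of "Suc i"] Suc.prems by simp
    have eq: "coeff V (d + i) = coeff ([:-\<alpha>, 1:] * V) (Suc (d + i)) + \<alpha> * coeff V (d + Suc i)"
      by simp
    have "norm (coeff V (d + i)) \<le> C * r ^ i + norm \<alpha> * (D * r ^ Suc i)"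
      unfolding eq
      by (intro norm_triangle_le add_mono bd)
        (use IH in \<open>auto simp: norm_mult intro: mult_left_mono\<close>)
    also have "\<dots> = (C + norm \<alpha> * r * D) * r ^ i" by (simp add: algebra_simps)
    finally show ?case using D by simp
  qed
  from this[of i "Suc (degree V)"] show ?thesis by (simp add: D_def)
qed

lemma coeff_bound_div_large_root:
  fixes V :: "'a::real_normed_field poly"
  assumes r: "r > 0" "1 < norm \<beta> * r" and C: "0 \<le> C"
    and bd: "\<And>i. norm (coeff ([:-\<beta>, 1:] * V) i) \<le> C * r ^ i"
  shows "norm (coeff V i) \<le> C * r / (norm \<beta> * r - 1) * r ^ i"
proof -
  \<comment> \<open>Here D solves D + C r = |\<beta>| r D, which closes the upward
    recurrence.\<close>
  define D where "D = C * r / (norm \<beta> * r - 1)"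
  have D: "D \<ge> 0" "D + C * r = norm \<beta> * r * D"
    using r C by (auto simp: D_def field_simps)
  have \<beta>: "norm \<beta> > 0" using r by (auto intro!: Nat.gr0I)
  have "norm \<beta> * norm (coeff V i) \<le> norm \<beta> * (D * r ^ i)"
  proof (induction i)
    case 0
    have "norm \<beta> * r * norm (coeff V 0) \<le> C * r"
      using bd[of 0] r by (simp add: norm_mult mult.commute mult.left_commute)
    also have "\<dots> \<le> norm \<beta> * r * D" using D by linarith
    finally show ?case using r by (simp add: mult.assoc mult.left_commute)
  next
    case (Suc i)
    have IH: "norm (coeff V i) \<le> D * r ^ i" using Suc \<beta> by simp
    have eq: "\<beta> * coeff V (Suc i) = coeff V i - coeff ([:-\<beta>, 1:] * V) (Suc i)"
      by simp
    have "norm \<beta> * norm (coeff V (Suc i)) = norm (coeff V i - coeff ([:-\<beta>, 1:] * V) (Suc i))"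
      by (simp only: norm_mult[symmetric] eq)
    also have "\<dots> \<le> D * r ^ i + C * r ^ Suc i"
      by (rule order.trans[OF norm_triangle_ineq4 add_mono[OF IH bd]])
    also have "\<dots> = (D + C * r) * r ^ i" by (simp add: algebra_simps)
    also have "\<dots> = norm \<beta> * (D * r ^ Suc i)" unfolding D by (simp add: algebra_simps)
    finally show ?case .
  qed
  then show ?thesis using \<beta> by (simp only: mult_le_cancel_left_pos D_def)
qed

text \<open>Each small root costs one low degree, hence the offset \<open>size R\<close>. The
  constant \<kappa> is chosen before V and C; this is what later makes the decay uniform in the
  matrix size and the row.\<close>

lemma coeff_bound_div_small_roots:
  fixes R :: "'a::real_normed_field multiset"
  assumes r: "r > 0" and R: "\<forall>z\<in>#R. norm z * r < 1"
  shows "\<exists>\<kappa>\<ge>0. \<forall>V C. 0 \<le> C \<longrightarrow>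
    (\<forall>i. norm (coeff ((\<Prod>z\<in>#R. [:-z, 1:]) * V) (size R + i)) \<le> C * r ^ i) \<longrightarrow>
    (\<forall>i. norm (coeff V i) \<le> \<kappa> * C * r ^ i)"
  using R
proof (induction R)
  case empty
  show ?case by (rule exI[of _ 1]) simp
next
  case (add z R)
  then obtain \<kappa> where \<kappa>: "\<kappa> \<ge> 0" "\<And>V C i. 0 \<le> C \<Longrightarrow>
    (\<And>i. norm (coeff ((\<Prod>z\<in>#R. [:-z, 1:]) * V) (size R + i)) \<le> C * r ^ i) \<Longrightarrow>
    norm (coeff V i) \<le> \<kappa> * C * r ^ i" by auto
  have z: "norm z * r < 1" using add.prems by simp
  show ?case
  proof (intro exI[of _ "\<kappa> / (1 - norm z * r)"] conjI allI impI)
    fix V C i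
    assume C: "0 \<le> C" and bd: "\<forall>i. norm (coeff ((\<Prod>x\<in>#add_mset z R. [:- x, 1:]) * V)
      (size (add_mset z R) + i)) \<le> C * r ^ i"
    have "norm (coeff ((\<Prod>z\<in>#R. [:-z, 1:]) * V) (size R + i)) \<le> C / (1 - norm z * r) * r ^ i" for i
      by (rule coeff_bound_div_small_root[OF r z C])
        (use bd in \<open>simp only: image_mset_add_mset prod_mset.add_mset size_add_mset mult.assoc add_Suc\<close>)
    then have "norm (coeff V i) \<le> \<kappa> * (C / (1 - norm z * r)) * r ^ i"
      using z C by (intro \<kappa>) auto
    then show "norm (coeff V i) \<le> \<kappa> / (1 - norm z * r) * C * r ^ i" by simp
  qed (use \<kappa> z in auto)
qed

lemma coeff_bound_div_large_roots:
  fixes R :: "'a::real_normed_field multiset"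
  assumes r: "r > 0" and R: "\<forall>z\<in>#R. 1 < norm z * r"
  shows "\<exists>\<kappa>\<ge>0. \<forall>V C. 0 \<le> C \<longrightarrow>
    (\<forall>i. norm (coeff ((\<Prod>z\<in>#R. [:-z, 1:]) * V) i) \<le> C * r ^ i) \<longrightarrow>
    (\<forall>i. norm (coeff V i) \<le> \<kappa> * C * r ^ i)"
  using R
proof (induction R)
  case empty
  show ?case by (rule exI[of _ 1]) simp
next
  case (add z R)
  then obtain \<kappa> where \<kappa>: "\<kappa> \<ge> 0" "\<And>V C i. 0 \<le> C \<Longrightarrow>
    (\<And>i. norm (coeff ((\<Prod>z\<in>#R. [:-z, 1:]) * V) i) \<le> C * r ^ i) \<Longrightarrow>
    norm (coeff V i) \<le> \<kappa> * C * r ^ i" by auto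
  have z: "1 < norm z * r" using add.prems by simp
  show ?case
  proof (intro exI[of _ "\<kappa> * r / (norm z * r - 1)"] conjI allI impI)
    fix V C i
    assume C: "0 \<le> C" and bd: "\<forall>i. norm (coeff ((\<Prod>x\<in>#add_mset z R. [:- x, 1:]) * V) i)
      \<le> C * r ^ i"
    have "norm (coeff ((\<Prod>z\<in>#R. [:-z, 1:]) * V) i) \<le> C * r / (norm z * r - 1) * r ^ i" for i
      by (rule coeff_bound_div_large_root[OF r z C])
        (use bd in \<open>simp only: image_mset_add_mset prod_mset.add_mset mult.assoc\<close>)
    then have "norm (coeff V i) \<le> \<kappa> * (C * r / (norm z * r - 1)) * r ^ i"
      using z C r by (intro \<kappa>) auto
    then show "norm (coeff V i) \<le> \<kappa> * r / (norm z * r - 1) * C * r ^ i" by (simp add: mult_ac)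
  qed (use \<kappa> z r in auto)
qed

lemma size_filter_proots:
  assumes "p \<noteq> 0"
  shows "size (filter_mset P (proots p)) = num_roots p P"
proof -
  have "set_mset (filter_mset P (proots p)) = {z. poly p z = 0 \<and> P z}"
    using assms by auto
  then show ?thesis
    using assms unfolding size_multiset_overloaded_eq num_roots_def
    by (auto intro!: sum.cong)
qed

text \<open>The order of division matters. Removing the small roots first uses up exactly the
  uncontrolled low degrees and leaves a bound from degree 0 on, as the upward recurrence for the
  large roots requires.\<close>

lemma monic_coeff_bound:
  fixes K :: "complex poly"
  assumes "lead_coeff K = 1" "r > 1"
    and "\<And>z. poly K z = 0 \<Longrightarrow> cmod z \<noteq> 1"
    and "\<And>z. poly K z = 0 \<Longrightarrow> cmod z < 1 \<Longrightarrow> cmod z * r < 1"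
  shows "\<exists>\<kappa>\<ge>0. \<forall>V C. 0 \<le> C \<longrightarrow>
    (\<forall>i. cmod (coeff (K * V) (num_roots K (\<lambda>z. cmod z < 1) + i)) \<le> C * r ^ i) \<longrightarrow>
    (\<forall>i. cmod (coeff V i) \<le> \<kappa> * C * r ^ i)"
proof -
  define A where "A = filter_mset (\<lambda>z. cmod z < 1) (proots K)"
  define B where "B = filter_mset (\<lambda>z. \<not> cmod z < 1) (proots K)"
  have r0: "r > 0" using assms(2) by simp
  have K0: "K \<noteq> 0" using assms(1) by auto
  have K: "K = (\<Prod>z\<in>#A. [:-z, 1:]) * (\<Prod>z\<in>#B. [:-z, 1:])"
    using complex_poly_decompose_multiset[of K] assms(1)
    unfolding A_def B_def prod_mset.union[symmetric] image_mset_union[symmetric]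
    by (simp flip: multiset_partition)
  have sA: "size A = num_roots K (\<lambda>z. cmod z < 1)"
    unfolding A_def by (rule size_filter_proots[OF K0])
  have "\<forall>z\<in>#A. cmod z * r < 1"
    using assms(4) K0 by (auto simp: A_def)
  from coeff_bound_div_small_roots[OF r0 this] obtain \<kappa>1 where \<kappa>1: "\<kappa>1 \<ge> 0"
    "\<forall>V C. 0 \<le> C \<longrightarrow>
      (\<forall>i. cmod (coeff ((\<Prod>z\<in>#A. [:-z, 1:]) * V) (size A + i)) \<le> C * r ^ i) \<longrightarrow>
      (\<forall>i. cmod (coeff V i) \<le> \<kappa>1 * C * r ^ i)"
    by (elim exE conjE)
  have "\<forall>z\<in>#B. 1 < cmod z * r"
  proof
    fix z assume "z \<in># B"
    then have "1 < cmod z" using assms(3)[of z] K0 by (auto simp: B_def)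
    then show "1 < cmod z * r" using assms(2) less_1_mult by blast
  qed
  from coeff_bound_div_large_roots[OF r0 this] obtain \<kappa>2 where \<kappa>2: "\<kappa>2 \<ge> 0"
    "\<forall>V C. 0 \<le> C \<longrightarrow>
      (\<forall>i. cmod (coeff ((\<Prod>z\<in>#B. [:-z, 1:]) * V) i) \<le> C * r ^ i) \<longrightarrow>
      (\<forall>i. cmod (coeff V i) \<le> \<kappa>2 * C * r ^ i)"
    by (elim exE conjE)
  show ?thesis
  proof (intro exI[of _ "\<kappa>2 * \<kappa>1"] conjI allI impI)
    fix V C i
    assume C: "0 \<le> C"
      and bd: "\<forall>i. cmod (coeff (K * V) (num_roots K (\<lambda>z. cmod z < 1) + i)) \<le> C * r ^ i"
    have "cmod (coeff V i) \<le> \<kappa>2 * (\<kappa>1 * C) * r ^ i"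
    proof (intro \<kappa>2(2)[rule_format] \<kappa>1(2)[rule_format] C)
      fix i
      show "cmod (coeff ((\<Prod>z\<in>#A. [:- z, 1:]) * ((\<Prod>z\<in>#B. [:- z, 1:]) * V)) (size A + i)) \<le> C * r ^ i"
        using bd unfolding sA mult.assoc[symmetric] K[symmetric] by simp
    qed (use \<kappa>1 C in auto)
    then show "cmod (coeff V i) \<le> \<kappa>2 * \<kappa>1 * C * r ^ i" by (simp add: mult_ac)
  qed (use \<kappa>1 \<kappa>2 in auto)
qed

section \<open>The Toeplitz quadratic form as a sum over roots of unity\<close>

definition banded_coeff :: "nat \<Rightarrow> (int \<Rightarrow> complex) \<Rightarrow> int \<Rightarrow> complex" where
  "banded_coeff n a m = (if \<bar>m\<bar> \<le> int n then a m else 0)"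

definition trig_symbol :: "nat \<Rightarrow> (int \<Rightarrow> complex) \<Rightarrow> real \<Rightarrow> complex" where
  "trig_symbol n a \<theta> = (\<Sum>m\<in>{-int n..int n}. a m * cis (of_int m * \<theta>))"

text \<open>For nonzero m this is a full geometric sum of an M-th root of unity q. If q were 1, then
  M would divide m, which |m| < M excludes.\<close>

lemma sum_cis_roots_of_unity:
  fixes m :: int and M :: nat
  assumes "M > 0" "\<bar>m\<bar> < int M"
  shows "(\<Sum>t<M. cis (of_int m * (2 * pi * real t / real M))) = (if m = 0 then of_nat M else 0)"
proof (cases "m = 0")
  case False
  define q where "q = cis (2 * pi * of_int m / real M)"
  have "q \<noteq> 1"
  proof
    assume "q = 1"
    then obtain k :: int where "2 * pi * of_int m / real M = 2 * pi * of_int k"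
      by (auto simp: q_def complex_eq_iff cos_one_2pi_int)
    then have "real_of_int m = of_int (k * int M)" using assms(1) by (simp add: field_simps)
    then have "m = k * int M" by (simp only: of_int_eq_iff)
    then have "int M dvd m" by simp
    then show False using dvd_imp_le_int[of m "int M"] assms False by auto
  qed
  moreover have "q ^ M = 1"
    using assms(1) by (simp add: q_def DeMoivre cis_multiple_2pi)
  moreover have "cis (of_int m * (2 * pi * real t / real M)) = q ^ t" for t
    by (simp add: q_def DeMoivre mult_ac)
  ultimately show ?thesis using False by (simp add: geometric_sum)
qed simp

text \<open>Expanding the symbol and |f|^2 produces only the frequencies m + j - i, of modulus at
  most N + n < M. No nonzero frequency is aliased to 0, so exactly the terms with m = i - j
  survive.\<close>

lemma sum_trig_symbol_quadratic_form:
  fixes x :: "nat \<Rightarrow> complex"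
  assumes M: "M > N + n"
  defines "\<theta> \<equiv> \<lambda>t. 2 * pi * real t / real M"
  defines "f \<equiv> \<lambda>\<theta>. \<Sum>j\<le>N. x j * cis (real j * \<theta>)"
  shows "(\<Sum>t<M. trig_symbol n a (\<theta> t) * of_real ((cmod (f (\<theta> t)))\<^sup>2)) =
    of_nat M * (\<Sum>j\<le>N. \<Sum>i\<le>N. x j * cnj (x i) * banded_coeff n a (int i - int j))"
proof -
  let ?I = "{-int n..int n}"
  have "trig_symbol n a t * of_real ((cmod (f t))\<^sup>2) =
    (\<Sum>j\<le>N. \<Sum>i\<le>N. \<Sum>m\<in>?I. x j * cnj (x i) * a m * cis (of_int (m + int j - int i) * t))" for t
  proof -
    have "of_real ((cmod (f t))\<^sup>2) = f t * cnj (f t)" by (rule complex_norm_square)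
    also have "\<dots> = (\<Sum>j\<le>N. \<Sum>i\<le>N. (x j * cis (real j * t)) * cnj (x i * cis (real i * t)))"
      unfolding f_def cnj_sum by (rule sum_product)
    finally show ?thesis
      unfolding trig_symbol_def
      by (simp only: sum_distrib_left sum_distrib_right, intro sum.cong refl)
        (simp add: cis_cnj divide_inverse algebra_simps flip: cis_divide cis_mult)
  qed
  then have "(\<Sum>t<M. trig_symbol n a (\<theta> t) * of_real ((cmod (f (\<theta> t)))\<^sup>2)) =
    (\<Sum>t<M. \<Sum>j\<le>N. \<Sum>i\<le>N. \<Sum>m\<in>?I.
      x j * cnj (x i) * a m * cis (of_int (m + int j - int i) * \<theta> t))" by simp
  also have "\<dots> = (\<Sum>j\<le>N. \<Sum>i\<le>N. \<Sum>m\<in>?I. \<Sum>t<M.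
      x j * cnj (x i) * a m * cis (of_int (m + int j - int i) * \<theta> t))"
    by (subst sum.swap, rule sum.cong[OF refl], subst sum.swap, rule sum.cong[OF refl], rule sum.swap)
  also have "\<dots> = (\<Sum>j\<le>N. \<Sum>i\<le>N. of_nat M * (x j * cnj (x i) * banded_coeff n a (int i - int j)))"
  proof (intro sum.cong refl)
    fix i j assume ij: "j \<in> {..N}" "i \<in> {..N}"
    have "(\<Sum>m\<in>?I. \<Sum>t<M. x j * cnj (x i) * a m * cis (of_int (m + int j - int i) * \<theta> t)) =
      (\<Sum>m\<in>?I. if m = int i - int j then of_nat M * (x j * cnj (x i) * a m) else 0)"
    proof (intro sum.cong refl)
      fix m assume "m \<in> ?I"
      then have "\<bar>m + int j - int i\<bar> < int M" using ij M by auto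
      then show "(\<Sum>t<M. x j * cnj (x i) * a m * cis (of_int (m + int j - int i) * \<theta> t)) =
        (if m = int i - int j then of_nat M * (x j * cnj (x i) * a m) else 0)"
        unfolding sum_distrib_left[symmetric] \<theta>_def
        using M by (subst sum_cis_roots_of_unity) auto
    qed
    also have "\<dots> = of_nat M * (x j * cnj (x i) * banded_coeff n a (int i - int j))"
      by (auto simp: banded_coeff_def)
    finally show "(\<Sum>m\<in>?I. \<Sum>t<M. x j * cnj (x i) * a m * cis (of_int (m + int j - int i) * \<theta> t)) =
      of_nat M * (x j * cnj (x i) * banded_coeff n a (int i - int j))" .
  qed
  finally show ?thesis by (simp add: sum_distrib_left)
qed

lemma sum_parseval_roots_of_unity:
  fixes x :: "nat \<Rightarrow> complex"
  assumes M: "M > N"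
  shows "(\<Sum>t<M. (cmod (\<Sum>j\<le>N. x j * cis (real j * (2 * pi * real t / real M))))\<^sup>2) =
    real M * (\<Sum>j\<le>N. (cmod (x j))\<^sup>2)"
proof -
  have "complex_of_real (\<Sum>t<M. (cmod (\<Sum>j\<le>N. x j * cis (real j * (2 * pi * real t / real M))))\<^sup>2) =
    of_nat M * (\<Sum>j\<le>N. \<Sum>i\<le>N. x j * cnj (x i) * banded_coeff 0 (\<lambda>_. 1) (int i - int j))"
    \<comment> \<open>Parseval is the case of the constant symbol 1, whose band has width 0.\<close>
    using sum_trig_symbol_quadratic_form[of N 0 M "\<lambda>_. 1" x] M by (simp add: trig_symbol_def)
  also have "\<dots> = of_nat M * (\<Sum>j\<le>N. \<Sum>i\<le>N. if i = j then x j * cnj (x i) else 0)"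
    unfolding banded_coeff_def by (intro arg_cong2[where f="(*)"] refl sum.cong) auto
  also have "\<dots> = complex_of_real (real M * (\<Sum>j\<le>N. (cmod (x j))\<^sup>2))"
    by (simp flip: complex_norm_square)
  finally show ?thesis by (simp only: of_real_eq_iff)
qed

lemma trig_symbol_real:
  assumes "\<forall>j. \<bar>j\<bar> \<le> int n \<longrightarrow> a j = cnj (a (- j))"
  shows "trig_symbol n a \<theta> = of_real (Re (trig_symbol n a \<theta>))"
proof -
  have "cnj (trig_symbol n a \<theta>) = (\<Sum>m\<in>{-int n..int n}. a (-m) * cis (of_int (-m) * \<theta>))"
    unfolding trig_symbol_def cnj_sum
    by (intro sum.cong refl) (subst assms[rule_format], auto simp: cis_cnj)
  also have "\<dots> = trig_symbol n a \<theta>"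
    unfolding trig_symbol_def
    by (rule sum.reindex_bij_witness[of _ uminus uminus]) auto
  finally have "Im (trig_symbol n a \<theta>) = 0"
    by (metis Reals_cnj_iff complex_is_Real_iff)
  then show ?thesis by (simp add: complex_eq_iff)
qed

text \<open>The factor in front has modulus 1, so a zero of the symbol at \<theta> is a root of the
  polynomial on the unit circle.\<close>

lemma poly_symbol_poly_cis:
  "poly (symbol_poly n a) (cis \<theta>) = cis (real n * \<theta>) * trig_symbol n a \<theta>"
  unfolding symbol_poly_def trig_symbol_def poly_sum poly_monom sum_distrib_left
proof (intro sum.cong refl)
  fix m assume m: "m \<in> {-int n..int n}"
  have "real (nat (m + int n)) = of_int m + real n"
    using m by (simp add: of_nat_nat)
  then show "a m * cis \<theta> ^ nat (m + int n) = cis (real n * \<theta>) * (a m * cis (of_int m * \<theta>))"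
    by (simp add: DeMoivre cis_mult algebra_simps)
qed

text \<open>Compactness gives a positive minimum of the modulus, and connectedness of the interval a
  constant sign. Which sign occurs is not determined by the hypotheses, hence the
  disjunction.\<close>

lemma trig_symbol_bounded_away_from_0:
  assumes herm: "\<forall>j. \<bar>j\<bar> \<le> int n \<longrightarrow> a j = cnj (a (- j))"
    and nz: "\<forall>z. poly (symbol_poly n a) z = 0 \<longrightarrow> cmod z \<noteq> 1"
  shows "\<exists>c>0. (\<forall>\<theta>\<in>{0..2*pi}. c \<le> Re (trig_symbol n a \<theta>)) \<or>
    (\<forall>\<theta>\<in>{0..2*pi}. Re (trig_symbol n a \<theta>) \<le> - c)"
proof -
  let ?g = "\<lambda>\<theta>. Re (trig_symbol n a \<theta>)"
  have cont: "continuous_on {0..2*pi} ?g"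
    unfolding trig_symbol_def cis.code by (intro continuous_intros)
  have g0: "?g \<theta> \<noteq> 0" for \<theta>
  proof
    assume "?g \<theta> = 0"
    then have "trig_symbol n a \<theta> = 0" using trig_symbol_real[OF herm] by (metis of_real_0)
    then show False using nz[rule_format, of "cis \<theta>"] by (simp add: poly_symbol_poly_cis)
  qed
  have "continuous_on {0..2*pi} (\<lambda>\<theta>. \<bar>?g \<theta>\<bar>)" by (intro continuous_intros cont)
  then obtain \<theta>0 where \<theta>0: "\<forall>\<theta>\<in>{0..2*pi}. \<bar>?g \<theta>0\<bar> \<le> \<bar>?g \<theta>\<bar>"
    using continuous_attains_inf[of "{0..2*pi}" "\<lambda>\<theta>. \<bar>?g \<theta>\<bar>"]
    by (auto simp del: atLeastAtMost_iff)
  have "(\<forall>\<theta>\<in>{0..2*pi}. 0 < ?g \<theta>) \<or> (\<forall>\<theta>\<in>{0..2*pi}. ?g \<theta> < 0)"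
  proof (rule ccontr)
    assume "\<not> ?thesis"
    then obtain s t where st: "s \<in> {0..2*pi}" "t \<in> {0..2*pi}" "?g s \<le> 0" "0 \<le> ?g t"
      by (auto simp: not_less)
    have "connected (?g ` {0..2*pi})"
      by (rule connected_continuous_image[OF cont connected_Icc])
    then have "0 \<in> ?g ` {0..2*pi}"
      by (rule connectedD_interval) (use st in auto)
    then show False using g0 by auto
  qed
  then show ?thesis
  proof
    assume "\<forall>\<theta>\<in>{0..2*pi}. 0 < ?g \<theta>"
    then show ?thesis using \<theta>0 g0[of \<theta>0] by (intro exI[of _ "\<bar>?g \<theta>0\<bar>"]) fastforce
  next
    assume "\<forall>\<theta>\<in>{0..2*pi}. ?g \<theta> < 0"
    then show ?thesis using \<theta>0 g0[of \<theta>0] by (intro exI[of _ "\<bar>?g \<theta>0\<bar>"]) fastforce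
  qed
qed

lemma banded_quadratic_form_lower_bound:
  assumes herm: "\<forall>j. \<bar>j\<bar> \<le> int n \<longrightarrow> a j = cnj (a (- j))"
    and nz: "\<forall>z. poly (symbol_poly n a) z = 0 \<longrightarrow> cmod z \<noteq> 1"
  shows "\<exists>c>0. \<forall>N x. c * (\<Sum>j\<le>N. (cmod (x j))\<^sup>2) \<le>
    cmod (\<Sum>j\<le>N. \<Sum>i\<le>N. x j * cnj (x i) * banded_coeff n a (int i - int j))"
proof -
  let ?g = "\<lambda>\<theta>. Re (trig_symbol n a \<theta>)"
  obtain c where c: "c > 0" "(\<forall>\<theta>\<in>{0..2*pi}. c \<le> ?g \<theta>) \<or> (\<forall>\<theta>\<in>{0..2*pi}. ?g \<theta> \<le> - c)"
    using trig_symbol_bounded_away_from_0[OF herm nz] by blast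
  show ?thesis
  proof (intro exI[of _ c] conjI allI c)
    fix N and x :: "nat \<Rightarrow> complex"
    \<comment> \<open>The least number of sample points for which the exact summation of the form
      applies; it also suffices for Parseval.\<close>
    define M where "M = Suc (N + n)"
    define \<theta> where "\<theta> = (\<lambda>t. 2 * pi * real t / real M)"
    define f where "f = (\<lambda>t. (cmod (\<Sum>j\<le>N. x j * cis (real j * \<theta> t)))\<^sup>2)"
    define Q where "Q = (\<Sum>j\<le>N. \<Sum>i\<le>N. x j * cnj (x i) * banded_coeff n a (int i - int j))"
    have M: "M > 0" "M > N + n" "M > N" by (auto simp: M_def)
    have \<theta>: "\<theta> t \<in> {0..2*pi}" if "t < M" for t
      using that by (auto simp: \<theta>_def field_simps)
    have f: "f t \<ge> 0" for t by (simp add: f_def)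
    have P: "(\<Sum>t<M. f t) = real M * (\<Sum>j\<le>N. (cmod (x j))\<^sup>2)"
      using sum_parseval_roots_of_unity[OF M(3)] by (simp add: f_def \<theta>_def)
    have "of_nat M * Q = (\<Sum>t<M. trig_symbol n a (\<theta> t) * of_real (f t))"
      using sum_trig_symbol_quadratic_form[OF M(2), of a x] by (simp add: f_def \<theta>_def Q_def)
    also have "\<dots> = of_real (\<Sum>t<M. ?g (\<theta> t) * f t)"
      by (subst trig_symbol_real[OF herm]) auto
    finally have "real M * cmod Q = \<bar>\<Sum>t<M. ?g (\<theta> t) * f t\<bar>"
      by (metis norm_mult norm_of_nat norm_of_real)
    \<comment> \<open>The weights f t are nonnegative and the symbol keeps one sign, so no
      cancellation occurs between the samples.\<close>
    also have "\<dots> \<ge> (\<Sum>t<M. c * f t)"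
      using c(2)
    proof
      assume "\<forall>\<theta>\<in>{0..2*pi}. c \<le> ?g \<theta>"
      then have "(\<Sum>t<M. c * f t) \<le> (\<Sum>t<M. ?g (\<theta> t) * f t)"
        using \<theta> f by (intro sum_mono mult_right_mono) auto
      then show ?thesis by linarith
    next
      assume "\<forall>\<theta>\<in>{0..2*pi}. ?g \<theta> \<le> - c"
      then have "(\<Sum>t<M. ?g (\<theta> t) * f t) \<le> (\<Sum>t<M. - c * f t)"
        using \<theta> f by (intro sum_mono mult_right_mono) auto
      then show ?thesis by (simp add: sum_negf)
    qed
    also have "(\<Sum>t<M. c * f t) = real M * (c * (\<Sum>j\<le>N. (cmod (x j))\<^sup>2))"
      using P by (simp add: sum_distrib_left[symmetric])
    finally show "c * (\<Sum>j\<le>N. (cmod (x j))\<^sup>2) \<le>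
      cmod (\<Sum>j\<le>N. \<Sum>i\<le>N. x j * cnj (x i) * banded_coeff n a (int i - int j))"
      using M(1) by (simp add: Q_def)
  qed
qed

section \<open>Invertibility, bounded inverse entries and Hermitian symmetry\<close>

lemma coeff_symbol_poly:
  "coeff (symbol_poly n a) i = banded_coeff n a (int i - int n)"
proof -
  have "coeff (symbol_poly n a) i = (\<Sum>m\<in>{-int n..int n}. if m = int i - int n then a m else 0)"
    unfolding symbol_poly_def coeff_sum coeff_monom
    by (intro sum.cong refl) auto
  also have "\<dots> = banded_coeff n a (int i - int n)"
    by (auto simp: banded_coeff_def)
  finally show ?thesis .
qed

lemma banded_toeplitz_index:
  assumes "i \<le> N" "j \<le> N"
  shows "banded_toeplitz n a N $$ (i, j) = banded_coeff n a (int j - int i)"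
  using assms by (auto simp: banded_toeplitz_def banded_coeff_def abs_minus_commute)

lemma banded_toeplitz_carrier: "banded_toeplitz n a N \<in> carrier_mat (Suc N) (Suc N)"
  by (simp add: banded_toeplitz_def)

lemma det_nonzero_if_quadratic_form_bounded_below:
  fixes A :: "complex mat"
  assumes A: "A \<in> carrier_mat n n" and c: "c > 0"
    and lb: "\<And>x. c * (\<Sum>j<n. (cmod (x j))\<^sup>2) \<le> cmod (\<Sum>j<n. \<Sum>i<n. x j * cnj (x i) * A $$ (j, i))"
  shows "det A \<noteq> 0"
proof
  assume "det A = 0"
  then obtain v where v: "v \<in> carrier_vec n" "v \<noteq> 0\<^sub>v n" "A *\<^sub>v v = 0\<^sub>v n"
    using det_0_iff_vec_prod_zero[OF A] by blast
  \<comment> \<open>The form conjugates the factor belonging to the column index, so a kernel vector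
    v has to be inserted as its conjugate: this turns the inner sum into a multiple of (A v)_j =
    0.\<close>
  have "(\<Sum>i<n. cnj (v $ j) * cnj (cnj (v $ i)) * A $$ (j, i)) = 0" if "j < n" for j
  proof -
    have "(\<Sum>i<n. cnj (v $ j) * cnj (cnj (v $ i)) * A $$ (j, i)) =
      cnj (v $ j) * (\<Sum>i<n. A $$ (j, i) * v $ i)"
      by (simp add: sum_distrib_left mult_ac)
    also have "(\<Sum>i<n. A $$ (j, i) * v $ i) = (A *\<^sub>v v) $ j"
      using A v(1) that by (auto simp: scalar_prod_def lessThan_atLeast0)
    finally show ?thesis using v(3) that by simp
  qed
  then have "c * (\<Sum>j<n. (cmod (v $ j))\<^sup>2) \<le> 0"
    using lb[of "\<lambda>j. cnj (v $ j)"] by simp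
  then have "(\<Sum>j<n. (cmod (v $ j))\<^sup>2) \<le> 0"
    using c by (simp add: mult_le_0_iff)
  moreover have "(\<Sum>j<n. (cmod (v $ j))\<^sup>2) \<ge> 0" by (intro sum_nonneg) simp
  ultimately have "\<forall>j<n. v $ j = 0"
    using sum_nonneg_eq_0_iff[of "{..<n}" "\<lambda>j. (cmod (v $ j))\<^sup>2"] by auto
  then have "v = 0\<^sub>v n" using v(1) by (intro eq_vecI) auto
  with v(2) show False by simp
qed

text \<open>Row k of B is a vector x with x A = e_k, so the form at x collapses to the conjugate of
  x_k. Hence c |x|^2 \<le> |x_k|, which bounds first x_k by 1 / c and then every other entry of the
  row.\<close>

lemma left_inverse_bound_if_quadratic_form_bounded_below:
  fixes A B :: "complex mat"
  assumes A: "A \<in> carrier_mat n n" and B: "B \<in> carrier_mat n n" "B * A = 1\<^sub>m n"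
    and c: "c > 0"
    and lb: "\<And>x. c * (\<Sum>j<n. (cmod (x j))\<^sup>2) \<le> cmod (\<Sum>j<n. \<Sum>i<n. x j * cnj (x i) * A $$ (j, i))"
    and kl: "k < n" "l < n"
  shows "cmod (B $$ (k, l)) \<le> 1 / c"
proof -
  define x where "x = (\<lambda>j. B $$ (k, j))"
  have row: "(\<Sum>j<n. x j * A $$ (j, i)) = (if i = k then 1 else 0)" if "i < n" for i
  proof -
    have "(\<Sum>j<n. x j * A $$ (j, i)) = (B * A) $$ (k, i)"
      using A B(1) that kl by (auto simp: x_def scalar_prod_def lessThan_atLeast0)
    then show ?thesis using that kl by (auto simp: B(2))
  qed
  have "(\<Sum>j<n. \<Sum>i<n. x j * cnj (x i) * A $$ (j, i)) = (\<Sum>i<n. cnj (x i) * (\<Sum>j<n. x j * A $$ (j, i)))"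
    by (subst sum.swap) (simp add: sum_distrib_left mult_ac)
  also have "\<dots> = (\<Sum>i<n. if i = k then cnj (x i) else 0)"
    by (intro sum.cong refl) (auto simp: row)
  also have "\<dots> = cnj (x k)" using kl by simp
  finally have le: "c * (\<Sum>j<n. (cmod (x j))\<^sup>2) \<le> cmod (x k)"
    using lb[of x] by simp
  have mem: "(cmod (x m))\<^sup>2 \<le> (\<Sum>j<n. (cmod (x j))\<^sup>2)" if "m < n" for m
    using that by (intro member_le_sum) auto
  have "c * (cmod (x k))\<^sup>2 \<le> cmod (x k)"
    using le mem[OF kl(1)] c by (smt (verit) mult_left_mono)
  then have xk: "c * cmod (x k) \<le> 1"
    by (cases "x k = 0") (auto simp: power2_eq_square)
  have "c * (cmod (x l))\<^sup>2 \<le> cmod (x k)"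
    using le mem[OF kl(2)] c by (smt (verit) mult_left_mono)
  then have "c * (c * (cmod (x l))\<^sup>2) \<le> 1"
    using xk c by (smt (verit) mult_left_mono)
  then have "(c * cmod (x l))\<^sup>2 \<le> 1\<^sup>2" by (simp add: power2_eq_square mult_ac)
  then have "c * cmod (x l) \<le> 1" by (rule power2_le_imp_le) simp
  then show ?thesis using c by (simp add: x_def field_simps)
qed

lemma mat_inv_carrier_inverse:
  assumes "A \<in> carrier_mat n n" "det A \<noteq> 0"
  shows "mat_inv A \<in> carrier_mat n n" "A * mat_inv A = 1\<^sub>m n" "mat_inv A * A = 1\<^sub>m n"
proof -
  \<comment> \<open>A nonzero determinant makes A a unit of the matrix ring, which rules out
    \<open>None\<close>. The argument \<open>()\<close> gives both facts the same value for the free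
    extra parameter of that ring.\<close>
  obtain B where "mat_inverse A = Some B"
    using mat_inverse(1)[OF assms(1), of "()"] det_non_zero_imp_unit[OF assms, of "()"]
    by (cases "mat_inverse A") auto
  then show "mat_inv A \<in> carrier_mat n n" "A * mat_inv A = 1\<^sub>m n" "mat_inv A * A = 1\<^sub>m n"
    using mat_inverse(2)[OF assms(1)] by (auto simp: mat_inv_def)
qed

text \<open>The conjugate transpose of a left inverse of a Hermitian matrix is a right inverse, and
  the two must coincide.\<close>

lemma hermitian_inverse_index:
  fixes A B :: "complex mat"
  assumes A: "A \<in> carrier_mat n n" and B: "B \<in> carrier_mat n n" "B * A = 1\<^sub>m n"
    and herm: "\<And>i j. i < n \<Longrightarrow> j < n \<Longrightarrow> A $$ (i, j) = cnj (A $$ (j, i))"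
    and kl: "k < n" "l < n"
  shows "B $$ (k, l) = cnj (B $$ (l, k))"
proof -
  define H where "H = mat n n (\<lambda>(i, j). cnj (B $$ (j, i)))"
  have H: "H \<in> carrier_mat n n" by (simp add: H_def)
  have "A * H = 1\<^sub>m n"
  proof (rule eq_matI)
    fix i j assume ij: "i < dim_row (1\<^sub>m n :: complex mat)" "j < dim_col (1\<^sub>m n :: complex mat)"
    then have "(A * H) $$ (i, j) = (\<Sum>m<n. A $$ (i, m) * cnj (B $$ (j, m)))"
      using A by (auto simp: H_def scalar_prod_def lessThan_atLeast0)
    also have "\<dots> = cnj (\<Sum>m<n. B $$ (j, m) * A $$ (m, i))"
      using ij by (auto simp: herm[of i] mult_ac)
    also have "(\<Sum>m<n. B $$ (j, m) * A $$ (m, i)) = (B * A) $$ (j, i)"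
      using ij A B(1) by (auto simp: scalar_prod_def lessThan_atLeast0)
    finally show "(A * H) $$ (i, j) = (1\<^sub>m n :: complex mat) $$ (i, j)"
      using ij by (auto simp: B(2))
  qed (use A H in auto)
  then have "H = B"
    using A B H assoc_mult_mat[of B n n A n H n] by simp
  then show ?thesis using kl by (metis H_def index_mat(1) old.prod.case)
qed

text \<open>For fixed i the differences i - j are distinct, so each band coefficient occurs at most
  once. The bound is independent of i and k.\<close>

lemma sum_norm_banded_coeff_le:
  "(\<Sum>j<k. cmod (banded_coeff n a (int i - int j))) \<le> (\<Sum>m\<in>{-int n..int n}. cmod (a m))"
proof -
  let ?J = "{j. j < k \<and> \<bar>int i - int j\<bar> \<le> int n}"
  have "(\<Sum>j<k. cmod (banded_coeff n a (int i - int j))) = (\<Sum>j\<in>?J. cmod (a (int i - int j)))"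
    by (rule sum.mono_neutral_cong_right) (auto simp: banded_coeff_def)
  also have "\<dots> = (\<Sum>m\<in>(\<lambda>j. int i - int j) ` ?J. cmod (a m))"
    by (subst sum.reindex) (auto simp: inj_on_def)
  also have "\<dots> \<le> (\<Sum>m\<in>{-int n..int n}. cmod (a m))"
    by (rule sum_mono2) auto
  finally show ?thesis .
qed

section \<open>Exponential decay of the inverse away from the diagonal\<close>

lemma row_decay_below_diagonal:
  fixes x :: "nat \<Rightarrow> complex"
  assumes r: "r > 1" and k: "k \<le> N"
    and \<kappa>: "\<forall>V C. 0 \<le> C \<longrightarrow>
      (\<forall>i. cmod (coeff (symbol_poly n a * V) (n + i)) \<le> C * r ^ i) \<longrightarrow>
      (\<forall>i. cmod (coeff V i) \<le> \<kappa> * C * r ^ i)"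
    and B: "0 \<le> B" "\<And>j. j \<le> N \<Longrightarrow> cmod (x j) \<le> B"
    and row: "\<And>i. i \<le> N \<Longrightarrow> (\<Sum>j\<le>N. x j * banded_coeff n a (int i - int j)) = (if i = k then 1 else 0)"
    and l: "l < k"
  shows "cmod (x l) \<le> \<kappa> * (B * (\<Sum>m\<in>{-int n..int n}. cmod (a m)) * r ^ n / r ^ k) * r ^ l"
proof -
  define S where "S = (\<Sum>m\<in>{-int n..int n}. cmod (a m))"
  define V where "V = (\<Sum>j<k. monom (x j) j)"
  have S: "S \<ge> 0" unfolding S_def by (intro sum_nonneg) simp
  have V: "coeff V j = (if j < k then x j else 0)" for j
    by (simp add: V_def coeff_sum)
  \<comment> \<open>The polynomial carries the symbol shifted by n, so degree n + i of the product
    is the truncated row x paired with column i of the matrix.\<close>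
  have coeff: "coeff (symbol_poly n a * V) (n + i) = (\<Sum>j<k. x j * banded_coeff n a (int i - int j))" for i
  proof -
    have "coeff (symbol_poly n a * V) (n + i) = (\<Sum>j<k. coeff (monom (x j) j * symbol_poly n a) (n + i))"
      by (simp add: V_def sum_distrib_left coeff_sum mult.commute)
    also have "\<dots> = (\<Sum>j<k. x j * banded_coeff n a (int i - int j))"
      by (intro sum.cong refl)
        (auto simp: coeff_monom_mult coeff_symbol_poly of_nat_diff banded_coeff_def)
    finally show ?thesis .
  qed
  have "cmod (coeff V l) \<le> \<kappa> * (B * S * r ^ n / r ^ k) * r ^ l"
  proof (rule \<kappa>[rule_format])
    show "0 \<le> B * S * r ^ n / r ^ k" using B S r by auto
    fix i
    show "cmod (coeff (symbol_poly n a * V) (n + i)) \<le> B * S * r ^ n / r ^ k * r ^ i"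
    proof (cases "n + i < k")
      case True
      \<comment> \<open>Column i of the band only reaches indices j \<le> i + n < k, so the
        truncation loses nothing. The full sum is 0 because i < k.\<close>
      have "(\<Sum>j<k. x j * banded_coeff n a (int i - int j)) = (\<Sum>j\<le>N. x j * banded_coeff n a (int i - int j))"
        using True k by (intro sum.mono_neutral_left) (auto simp: banded_coeff_def)
      also have "\<dots> = 0" using row[of i] True k by simp
      finally show ?thesis using B S r by (simp add: coeff)
    next
      case False
      have "cmod (\<Sum>j<k. x j * banded_coeff n a (int i - int j)) \<le>
        (\<Sum>j<k. B * cmod (banded_coeff n a (int i - int j)))"
        using B k by (intro order.trans[OF norm_sum] sum_mono) (auto simp: norm_mult intro!: mult_right_mono)
      also have "\<dots> \<le> B * S"
        using sum_norm_banded_coeff_le[of n a i k] B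
        by (auto simp: sum_distrib_left[symmetric] S_def intro: mult_left_mono)
      \<comment> \<open>From degree k on the quotient of powers is at least 1. Dividing by r^k puts
        into the constant the fact that growth only starts at degree k, and this is the source of
        the decay.\<close>
      also have "\<dots> \<le> B * S * (r ^ (n + i) / r ^ k)"
        using mult_left_mono[of 1 "r ^ (n + i) / r ^ k" "B * S"] False r B S
        by (simp add: le_divide_eq power_increasing)
      finally show ?thesis by (simp add: coeff power_add)
    qed
  qed
  then show ?thesis using l by (simp add: V S_def)
qed

lemma banded_toeplitz_inverse:
  assumes herm: "\<forall>j. \<bar>j\<bar> \<le> int n \<longrightarrow> a j = cnj (a (- j))"
    and nz: "\<forall>z. poly (symbol_poly n a) z = 0 \<longrightarrow> cmod z \<noteq> 1"
  shows "\<exists>c>0. \<forall>N. det (banded_toeplitz n a N) \<noteq> 0 \<and>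
    (\<forall>k\<le>N. \<forall>l\<le>N. cmod (mat_inv (banded_toeplitz n a N) $$ (k, l)) \<le> 1 / c)"
proof -
  obtain c where c: "c > 0" "\<And>N x. c * (\<Sum>j\<le>N. (cmod (x j))\<^sup>2) \<le>
    cmod (\<Sum>j\<le>N. \<Sum>i\<le>N. x j * cnj (x i) * banded_coeff n a (int i - int j))"
    using banded_quadratic_form_lower_bound[OF herm nz] by blast
  show ?thesis
  proof (intro exI[of _ c] conjI allI impI c(1))
    fix N
    let ?T = "banded_toeplitz n a N"
    have lb: "c * (\<Sum>j<Suc N. (cmod (x j))\<^sup>2) \<le>
      cmod (\<Sum>j<Suc N. \<Sum>i<Suc N. x j * cnj (x i) * ?T $$ (j, i))" for x
      unfolding lessThan_Suc_atMost using c(2)[where N=N and x=x] by (simp add: banded_toeplitz_index)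
    show det: "det ?T \<noteq> 0"
      by (rule det_nonzero_if_quadratic_form_bounded_below[OF banded_toeplitz_carrier c(1) lb])
    fix k l assume "k \<le> N" "l \<le> N"
    then show "cmod (mat_inv ?T $$ (k, l)) \<le> 1 / c"
      using mat_inv_carrier_inverse[OF banded_toeplitz_carrier det]
      by (intro left_inverse_bound_if_quadratic_form_bounded_below[OF banded_toeplitz_carrier _ _ c(1) lb]) auto
  qed
qed

lemma banded_toeplitz_inverse_decay:
  assumes herm: "\<forall>j. \<bar>j\<bar> \<le> int n \<longrightarrow> a j = cnj (a (- j))"
    and nz: "\<forall>z. poly (symbol_poly n a) z = 0 \<longrightarrow> cmod z \<noteq> 1"
    and monic: "lead_coeff (symbol_poly n a) = 1"
    and num: "num_roots (symbol_poly n a) (\<lambda>z. cmod z < 1) = n"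
    and \<rho>: "0 < \<rho>" "\<rho> < 1"
    and roots: "\<And>z. poly (symbol_poly n a) z = 0 \<Longrightarrow> cmod z < 1 \<Longrightarrow> cmod z < \<rho>"
  shows "\<exists>C\<ge>0. \<forall>N. \<forall>k\<le>N. \<forall>l\<le>N.
    cmod (mat_inv (banded_toeplitz n a N) $$ (k, l)) \<le> C * \<rho> powr real_of_int \<bar>int k - int l\<bar>"
proof -
  define r where "r = 1 / \<rho>"
  have r: "r > 1" using \<rho> by (simp add: r_def)
  have "\<exists>\<kappa>\<ge>0. \<forall>V C. 0 \<le> C \<longrightarrow>
    (\<forall>i. cmod (coeff (symbol_poly n a * V) (num_roots (symbol_poly n a) (\<lambda>z. cmod z < 1) + i)) \<le> C * r ^ i) \<longrightarrow>
    (\<forall>i. cmod (coeff V i) \<le> \<kappa> * C * r ^ i)"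
    using nz roots \<rho> by (intro monic_coeff_bound monic r) (auto simp: r_def)
  \<comment> \<open>The number of small roots equals n, so the degrees lost in the divisions are
    exactly those below the shift n of \<open>symbol_poly\<close>.\<close>
  then obtain \<kappa> where \<kappa>: "\<kappa> \<ge> 0" "\<forall>V C. 0 \<le> C \<longrightarrow>
    (\<forall>i. cmod (coeff (symbol_poly n a * V) (n + i)) \<le> C * r ^ i) \<longrightarrow>
    (\<forall>i. cmod (coeff V i) \<le> \<kappa> * C * r ^ i)" unfolding num by (elim exE conjE)
  obtain c where c: "c > 0" "\<And>N. det (banded_toeplitz n a N) \<noteq> 0"
    "\<And>N k l. k \<le> N \<Longrightarrow> l \<le> N \<Longrightarrow> cmod (mat_inv (banded_toeplitz n a N) $$ (k, l)) \<le> 1 / c"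
    using banded_toeplitz_inverse[OF herm nz] by blast
  define D where "D = \<kappa> * (1 / c * (\<Sum>m\<in>{-int n..int n}. cmod (a m)) * r ^ n)"
  have D: "D \<ge> 0" unfolding D_def using \<kappa>(1) c(1) r by (intro mult_nonneg_nonneg sum_nonneg) auto
  show ?thesis
  \<comment> \<open>The term 1 / c covers the diagonal, and D the entries off it.\<close>
  proof (intro exI[of _ "1 / c + D"] conjI allI impI)
    show "0 \<le> 1 / c + D" using c D by simp
    fix N k l :: nat assume kl: "k \<le> N" "l \<le> N"
    define T where "T = banded_toeplitz n a N"
    define X where "X = mat_inv T"
    have T: "T \<in> carrier_mat (Suc N) (Suc N)" unfolding T_def by (rule banded_toeplitz_carrier)
    have X: "X \<in> carrier_mat (Suc N) (Suc N)" "X * T = 1\<^sub>m (Suc N)"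
      using mat_inv_carrier_inverse[OF T] c(2)[of N] by (auto simp: X_def T_def)
    have Tij: "T $$ (i, j) = banded_coeff n a (int j - int i)" if "i \<le> N" "j \<le> N" for i j
      using that by (simp add: T_def banded_toeplitz_index)
    have hermX: "X $$ (i, j) = cnj (X $$ (j, i))" if "i \<le> N" "j \<le> N" for i j
    proof (rule hermitian_inverse_index[OF T X])
      fix i j assume "i < Suc N" "j < Suc N"
      then show "T $$ (i, j) = cnj (T $$ (j, i))"
        using herm[rule_format, of "int j - int i"] by (auto simp: Tij banded_coeff_def)
    qed (use that in auto)
    have row: "(\<Sum>j\<le>N. X $$ (p, j) * banded_coeff n a (int i - int j)) = (if i = p then 1 else 0)"
      if "p \<le> N" "i \<le> N" for p i
    proof -
      have "(\<Sum>j\<le>N. X $$ (p, j) * banded_coeff n a (int i - int j)) = (\<Sum>j<Suc N. X $$ (p, j) * T $$ (j, i))"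
        unfolding lessThan_Suc_atMost using that by (simp add: Tij)
      also have "\<dots> = (X * T) $$ (p, i)"
        using T X(1) that by (auto simp: scalar_prod_def lessThan_atLeast0)
      finally show ?thesis using that by (auto simp: X(2))
    qed
    have lower: "cmod (X $$ (p, q)) \<le> D * \<rho> powr real_of_int \<bar>int p - int q\<bar>"
      if "q < p" "p \<le> N" for p q
    proof -
      have "cmod (X $$ (p, q)) \<le>
        \<kappa> * (1 / c * (\<Sum>m\<in>{-int n..int n}. cmod (a m)) * r ^ n / r ^ p) * r ^ q"
        using c that row by (intro row_decay_below_diagonal[OF r that(2) \<kappa>(2)]) (auto simp: X_def T_def)
      also have "\<dots> = D * (r ^ q / r ^ p)" by (simp add: D_def)
      also have "r ^ q / r ^ p = \<rho> ^ (p - q)"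
        using \<rho> that by (simp add: r_def power_one_over power_diff field_simps)
      also have "\<dots> = \<rho> powr real_of_int \<bar>int p - int q\<bar>"
        using \<rho> that by (simp add: powr_realpow[symmetric] of_nat_diff)
      finally show ?thesis .
    qed
    have "cmod (X $$ (k, l)) \<le> (1 / c + D) * \<rho> powr real_of_int \<bar>int k - int l\<bar>"
    proof (cases k l rule: linorder_cases)
      case equal
      then show ?thesis using c(3)[OF kl] D \<rho> by (auto simp: X_def T_def)
    next
      case greater
      then have "cmod (X $$ (k, l)) \<le> D * \<rho> powr real_of_int \<bar>int k - int l\<bar>"
        using lower kl by blast
      also have "\<dots> \<le> (1 / c + D) * \<rho> powr real_of_int \<bar>int k - int l\<bar>"
        using c by (intro mult_right_mono) auto
      finally show ?thesis .
    next
      case less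
      \<comment> \<open>Entries above the diagonal are reflected to row l, where the column index
        lies left of the diagonal.\<close>
      have "cmod (X $$ (k, l)) = cmod (X $$ (l, k))" using hermX[OF kl] by simp
      also have "\<dots> \<le> D * \<rho> powr real_of_int \<bar>int k - int l\<bar>"
        using lower[OF less kl(2)] by (simp add: abs_minus_commute)
      also have "\<dots> \<le> (1 / c + D) * \<rho> powr real_of_int \<bar>int k - int l\<bar>"
        using c by (intro mult_right_mono) auto
      finally show ?thesis .
    qed
    then show "cmod (mat_inv (banded_toeplitz n a N) $$ (k, l)) \<le>
      (1 / c + D) * \<rho> powr real_of_int \<bar>int k - int l\<bar>" by (simp add: X_def T_def)
  qed
qed

section \<open>From exponential decay to the little-o estimate\<close>

theorem mainTheorem2:
  fixes n0 \<sigma> :: nat and a :: "int \<Rightarrow> complex" and \<alpha> :: "nat \<Rightarrow> complex"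
    and K :: "complex poly"
  assumes "n0 \<ge> 1"
    and "\<And>j. \<bar>j\<bar> \<le> int n0 \<Longrightarrow> a j = cnj (a (- j))"
    and "K = symbol_poly n0 a"
    and "\<And>z. poly K z = 0 \<Longrightarrow> cmod z \<noteq> 1"
    and "num_roots K (\<lambda>z. cmod z < 1) = n0"
    and "num_roots K (\<lambda>z. cmod z > 1) = n0"
    and "lead_coeff K = 1"
    and "bij_betw \<alpha> {1..\<sigma>} {z. poly K z = 0 \<and> cmod z < 1}"
  shows "(\<forall>N. invertible_mat (banded_toeplitz n0 a N)) \<and>
    (\<forall>x::real. 0 < x \<longrightarrow> x < 1 \<longrightarrow>
      (\<forall>(b::real) (\<rho>::real).
         0 < b \<longrightarrow> b < 1 \<longrightarrow> \<rho> < 1 \<longrightarrow> \<rho> > Max ((\<lambda>i. cmod (\<alpha> i)) ` {1..\<sigma>}) \<longrightarrow>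
         (\<forall>\<epsilon>>0. \<exists>N\<^sub>1. \<forall>N\<ge>N\<^sub>1. \<forall>k\<le>N. \<forall>l\<le>N.
            real_of_int \<bar>int k - int l\<bar> = real N * x \<longrightarrow>
            cmod (mat_inv (banded_toeplitz n0 a N) $$ (k, l))
              \<le> \<epsilon> * \<rho> powr (b * real_of_int \<bar>int k - int l\<bar>))))"
proof (intro conjI allI impI)
  have herm: "\<forall>j. \<bar>j\<bar> \<le> int n0 \<longrightarrow> a j = cnj (a (- j))"
    and nz: "\<forall>z. poly (symbol_poly n0 a) z = 0 \<longrightarrow> cmod z \<noteq> 1"
    using assms(2,4) unfolding assms(3) by blast+
  {
    fix N
    let ?T = "banded_toeplitz n0 a N"
    have "det ?T \<noteq> 0" using banded_toeplitz_inverse[OF herm nz] by blast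
    note inv = mat_inv_carrier_inverse[OF banded_toeplitz_carrier this]
    show "invertible_mat ?T"
      unfolding invertible_mat_def inverts_mat_def
      using inv banded_toeplitz_carrier[of n0 a N] by (intro conjI exI[of _ "mat_inv ?T"]) auto
  }
  fix x b \<rho> \<epsilon> :: real
  assume x: "0 < x" "x < 1" and b: "0 < b" "b < 1" and \<epsilon>: "0 < \<epsilon>"
    and \<rho>1: "\<rho> < 1" and \<rho>: "\<rho> > Max ((\<lambda>i. cmod (\<alpha> i)) ` {1..\<sigma>})"
  have im: "\<alpha> ` {1..\<sigma>} = {z. poly K z = 0 \<and> cmod z < 1}"
    using assms(8) by (rule bij_betw_imp_surj_on)
  have roots: "cmod z < \<rho>" if "poly K z = 0" "cmod z < 1" for z
  proof -
    have "z \<in> \<alpha> ` {1..\<sigma>}" using that im by blast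
    then have "cmod z \<le> Max ((\<lambda>i. cmod (\<alpha> i)) ` {1..\<sigma>})" by (auto intro!: Max_ge)
    then show ?thesis using \<rho> by simp
  qed
  \<comment> \<open>An empty set would make the root count 0, against n0 \<ge> 1. So the maximum is
    taken over a nonempty set, and \<rho> exceeds the modulus of an actual root, which makes it
    positive.\<close>
  have "{z. poly K z = 0 \<and> cmod z < 1} \<noteq> {}"
    using assms(1,5) unfolding num_roots_def by (metis not_one_le_zero sum.empty)
  then have \<rho>0: "0 < \<rho>" using roots by (auto intro: le_less_trans[OF norm_ge_zero])
  obtain C where C: "C \<ge> 0" "\<And>N k l. k \<le> N \<Longrightarrow> l \<le> N \<Longrightarrow>
    cmod (mat_inv (banded_toeplitz n0 a N) $$ (k, l)) \<le> C * \<rho> powr real_of_int \<bar>int k - int l\<bar>"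
    using banded_toeplitz_inverse_decay[OF herm nz _ _ \<rho>0 \<rho>1] assms(5,7) roots
    unfolding assms(3) by blast
  \<comment> \<open>At distance N x the decay \<rho>^(N x) splits into q^N and the required
    \<rho>^(b N x). Since b < 1 and x > 0, the spare factor q^N tends to 0 and absorbs the constant
    C.\<close>
  define q where "q = \<rho> powr ((1 - b) * x)"
  have q: "0 < q" "q < 1"
    using powr_less_mono2[of "(1 - b) * x" \<rho> 1] \<rho>0 \<rho>1 b x by (auto simp: q_def)
  have "(\<lambda>N. C * q ^ N) \<longlonglongrightarrow> C * 0"
    using q by (intro tendsto_mult tendsto_const LIMSEQ_power_zero) auto
  then have "eventually (\<lambda>N. C * q ^ N < \<epsilon>) sequentially"
    using \<epsilon> by (intro order_tendstoD(2)) auto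
  then obtain N1 where N1: "\<And>N. N \<ge> N1 \<Longrightarrow> C * q ^ N < \<epsilon>"
    unfolding eventually_sequentially by blast
  show "\<exists>N\<^sub>1. \<forall>N\<ge>N\<^sub>1. \<forall>k\<le>N. \<forall>l\<le>N.
    real_of_int \<bar>int k - int l\<bar> = real N * x \<longrightarrow>
    cmod (mat_inv (banded_toeplitz n0 a N) $$ (k, l)) \<le> \<epsilon> * \<rho> powr (b * real_of_int \<bar>int k - int l\<bar>)"
  proof (intro exI[of _ N1] allI impI)
    fix N k l
    assume N: "N \<ge> N1" and kl: "k \<le> N" "l \<le> N" and d: "real_of_int \<bar>int k - int l\<bar> = real N * x"
    have "\<rho> powr (real N * x) = \<rho> powr ((1 - b) * x * real N) * \<rho> powr (b * (real N * x))"
      by (simp add: powr_add[symmetric] algebra_simps)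
    also have "\<rho> powr ((1 - b) * x * real N) = q ^ N"
      using q by (simp add: q_def powr_powr[symmetric] powr_realpow)
    finally have "C * \<rho> powr (real N * x) = C * q ^ N * \<rho> powr (b * (real N * x))" by simp
    also have "\<dots> \<le> \<epsilon> * \<rho> powr (b * (real N * x))"
      using N1[OF N] by (intro mult_right_mono) auto
    finally show "cmod (mat_inv (banded_toeplitz n0 a N) $$ (k, l)) \<le>
      \<epsilon> * \<rho> powr (b * real_of_int \<bar>int k - int l\<bar>)"
      using C(2)[OF kl] unfolding d by linarith
  qed
qed

end
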